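(* Let $G$ be a group acting on a field $L$ by automorphisms, let $K\subseteq L^G$ be a subring, and let $R=K[a_1,\dots,a_n]\subseteq L$ be a finitely generated $G$-stable $K$-subalgebra with $\operatorname{Quot}(R)=L$. Let $E\subseteq L[y_1,\dots,y_n]$ be a tamely extended Derksen ideal with respect to $a_1,\dots,a_n$. Let $\mathcal G$ be a reduced Gr\"obner basis of $E$ with respect to an arbitrary monomial ordering, and let $A\subseteq L$ be the $K$-subalgebra generated by the coefficients of all polynomials from $\mathcal G$. Then \[ L^G=\operatorname{Quot}(A). \]
   Context: Rings are commutative with identity. $\operatorname{Quot}$ denotes the field of fractions (taken inside $L$). $G$ acts on $L[y_1,\dots,y_n]$ coefficient-wise, fixing the indeterminates $y_i$. Reduced Gr\"obner bases consist of monic polynomials. The Derksen ideal with respect to $a_1,\dots,a_n$ is $D_{a_1,\dots,a_n}:=\bigcap_{\sigma\in G}(y_1-\sigma\cdot a_1,\dots,y_n-\sigma\cdot a_n)\subseteq L[y_1,\dots,y_n]$. An extended Derksen ideal (with respect to $a_1,\dots,a_n$) is a proper $G$-stable ideal $E\subsetneqq L[y_1,\dots,y_n]$ containing $D_{a_1,\dots,a_n}$. It is called tamely extended if, with $I:=\{f(a_1,\dots,a_n)\mid f\in K[y_1,\dots,y_n]\cap E\}\subseteq R$, the intersection $\bigcap_{\sigma\in G}\sigma\cdot I$ is nilpotent. *)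

theory Defs
  imports
    "HOL-Library.Poly_Mapping"
    "HOL-Algebra.Algebra"
    "HOL-Algebra.Algebraic_Closure_Type"
begin

text \<open>
  The field L is the universe of a type \<open>'l::field\<close>, and \<open>('n, 'l) mpoly\<close> is the polynomial ring
  over L in the indeterminates \<open>y_i\<close>, where \<open>i\<close> ranges over the finite type \<open>'n\<close>. Notions of
  HOL-Algebra are applied to both rings through \<open>ring_of_type_algebra\<close>.
\<close>

type_synonym ('n, 'l) mpoly = "('n \<Rightarrow>\<^sub>0 nat) \<Rightarrow>\<^sub>0 'l"

abbreviation type_ring :: "'a::comm_ring_1 ring"
  where "type_ring \<equiv> ring_of_type_algebra"

subsection \<open>Groups acting on a field, subalgebras, quotient fields\<close>

definition acts_by_automorphisms :: "('g, 'm) monoid_scheme \<Rightarrow> ('g \<Rightarrow> 'l::field \<Rightarrow> 'l) \<Rightarrow> bool"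
  where "acts_by_automorphisms G act \<longleftrightarrow>
    group_action G UNIV act \<and> (\<forall>\<sigma>\<in>carrier G. act \<sigma> \<in> ring_iso type_ring type_ring)"

definition fixed_field :: "('g, 'm) monoid_scheme \<Rightarrow> ('g \<Rightarrow> 'l::field \<Rightarrow> 'l) \<Rightarrow> 'l set"
  where "fixed_field G act = {x. \<forall>\<sigma>\<in>carrier G. act \<sigma> x = x}"

text \<open>A K-subalgebra is the same as a subring containing K.\<close>

definition subalgebra_gen :: "'l::field set \<Rightarrow> 'l set \<Rightarrow> 'l set"
  where "subalgebra_gen K S = generate_ring type_ring (K \<union> S)"

definition quot_field :: "'l::field set \<Rightarrow> 'l set"
  where "quot_field A = {x / y | x y. x \<in> A \<and> y \<in> A \<and> y \<noteq> 0}"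

text \<open>
  In \<open>ideals_set\<close> multiplication is the product of ideals and the unit is the ring R itself, so
  \<open>[^]\<close> is the usual power of ideals of the subring R.
\<close>

definition nilpotent_ideal :: "'l::field set \<Rightarrow> 'l set \<Rightarrow> bool"
  where "nilpotent_ideal R J \<longleftrightarrow>
    (\<exists>k::nat. J [^]\<^bsub>ideals_set (type_ring\<lparr>carrier := R\<rparr>)\<^esub> k = {0})"

subsection \<open>Polynomials\<close>

definition Var :: "'n \<Rightarrow> ('n, 'l::field) mpoly"
  where "Var i = Poly_Mapping.single (Poly_Mapping.single i 1) 1"

definition Const :: "'l::field \<Rightarrow> ('n, 'l) mpoly"
  where "Const c = Poly_Mapping.single 0 c"

definition poly_eval :: "('n::finite \<Rightarrow> 'l::field) \<Rightarrow> ('n, 'l) mpoly \<Rightarrow> 'l"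
  where "poly_eval a f =
    (\<Sum>m\<in>Poly_Mapping.keys f. Poly_Mapping.lookup f m * (\<Prod>i\<in>UNIV. a i ^ Poly_Mapping.lookup m i))"

definition polys_over :: "'l::field set \<Rightarrow> ('n, 'l) mpoly set"
  where "polys_over K = {f. range (Poly_Mapping.lookup f) \<subseteq> K}"

definition coeffs_of :: "('n, 'l::field) mpoly set \<Rightarrow> 'l set"
  where "coeffs_of B = (\<Union>g\<in>B. Poly_Mapping.lookup g ` Poly_Mapping.keys g)"

subsection \<open>Derksen ideals\<close>

definition derksen_ideal ::
    "('g, 'm) monoid_scheme \<Rightarrow> ('g \<Rightarrow> 'l::field \<Rightarrow> 'l) \<Rightarrow> ('n::finite \<Rightarrow> 'l) \<Rightarrow> ('n, 'l) mpoly set"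
  where "derksen_ideal G act a =
    (\<Inter>\<sigma>\<in>carrier G. Idl\<^bsub>type_ring\<^esub> (range (\<lambda>i. Var i - Const (act \<sigma> (a i)))))"

definition extended_derksen_ideal ::
    "('g, 'm) monoid_scheme \<Rightarrow> ('g \<Rightarrow> 'l::field \<Rightarrow> 'l) \<Rightarrow> ('n::finite \<Rightarrow> 'l) \<Rightarrow> ('n, 'l) mpoly set \<Rightarrow> bool"
  where "extended_derksen_ideal G act a E \<longleftrightarrow>
    ideal E type_ring \<and> E \<noteq> UNIV \<and>
    (\<forall>\<sigma>\<in>carrier G. Poly_Mapping.map (act \<sigma>) ` E \<subseteq> E) \<and>
    derksen_ideal G act a \<subseteq> E"

definition tamely_extended_derksen_ideal ::
    "('g, 'm) monoid_scheme \<Rightarrow> ('g \<Rightarrow> 'l::field \<Rightarrow> 'l) \<Rightarrow> 'l set \<Rightarrow> ('n::finite \<Rightarrow> 'l) \<Rightarrow>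
      ('n, 'l) mpoly set \<Rightarrow> bool"
  where "tamely_extended_derksen_ideal G act K a E \<longleftrightarrow>
    extended_derksen_ideal G act a E \<and>
    nilpotent_ideal (subalgebra_gen K (range a))
      (\<Inter>\<sigma>\<in>carrier G. act \<sigma> ` (poly_eval a ` (polys_over K \<inter> E)))"

subsection \<open>Groebner bases\<close>

text \<open>
  Monomials are written additively, as exponent vectors. As there are finitely many indeterminates,
  a monomial ordering in the sense below is automatically a well-ordering.
\<close>

definition monomial_ordering :: "(('n::finite \<Rightarrow>\<^sub>0 nat) \<Rightarrow> ('n \<Rightarrow>\<^sub>0 nat) \<Rightarrow> bool) \<Rightarrow> bool"
  where "monomial_ordering mle \<longleftrightarrow>
    linear_order {(s, t). mle s t} \<and>
    (\<forall>t. mle 0 t) \<and>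
    (\<forall>s t u. mle s t \<longrightarrow> mle (s + u) (t + u))"

text \<open>Only meaningful for \<open>f \<noteq> 0\<close>.\<close>

definition lead_monom ::
    "(('n \<Rightarrow>\<^sub>0 nat) \<Rightarrow> ('n \<Rightarrow>\<^sub>0 nat) \<Rightarrow> bool) \<Rightarrow> ('n, 'l::field) mpoly \<Rightarrow> ('n \<Rightarrow>\<^sub>0 nat)"
  where "lead_monom mle f =
    (THE m. m \<in> Poly_Mapping.keys f \<and> (\<forall>t\<in>Poly_Mapping.keys f. mle t m))"

definition lead_ideal ::
    "(('n \<Rightarrow>\<^sub>0 nat) \<Rightarrow> ('n \<Rightarrow>\<^sub>0 nat) \<Rightarrow> bool) \<Rightarrow> ('n, 'l::field) mpoly set \<Rightarrow> ('n, 'l) mpoly set"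
  where "lead_ideal mle S =
    Idl\<^bsub>type_ring\<^esub> ((\<lambda>f. Poly_Mapping.single (lead_monom mle f) 1) ` (S - {0}))"

definition groebner_basis ::
    "(('n \<Rightarrow>\<^sub>0 nat) \<Rightarrow> ('n \<Rightarrow>\<^sub>0 nat) \<Rightarrow> bool) \<Rightarrow> ('n, 'l::field) mpoly set \<Rightarrow> ('n, 'l) mpoly set \<Rightarrow> bool"
  where "groebner_basis mle E B \<longleftrightarrow>
    finite B \<and> B \<subseteq> E \<and> lead_ideal mle B = lead_ideal mle E"

definition reduced_groebner_basis ::
    "(('n \<Rightarrow>\<^sub>0 nat) \<Rightarrow> ('n \<Rightarrow>\<^sub>0 nat) \<Rightarrow> bool) \<Rightarrow> ('n, 'l::field) mpoly set \<Rightarrow> ('n, 'l) mpoly set \<Rightarrow> bool"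
  where "reduced_groebner_basis mle E B \<longleftrightarrow>
    groebner_basis mle E B \<and>
    (\<forall>g\<in>B. g \<noteq> 0 \<and> Poly_Mapping.lookup g (lead_monom mle g) = 1) \<and>
    (\<forall>g\<in>B. \<forall>h\<in>B - {g}. \<forall>t\<in>Poly_Mapping.keys g. \<nexists>u. t = lead_monom mle h + u)"

end

theory Submission
  imports Defs
begin

text \<open>
  Write \<open>L^G\<close> for the fixed field and call a monomial reducible if it is divisible by the leading
  monomial of a Groebner basis element.

  \<^emph>\<open>The coefficients of the basis are invariant.\<close> For an element \<open>g\<close> of the reduced Groebner basis
  and \<open>\<sigma>\<close> in \<open>G\<close>, the difference of \<open>\<sigma> g\<close> and \<open>g\<close> lies in \<open>E\<close> and involves only monomials of \<open>g\<close>
  other than the leading one, because \<open>g\<close> is monic. By reducedness none of these is reducible, whereas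
  the leading monomial of a nonzero element of \<open>E\<close> is. So the difference vanishes, which gives
  \<open>Quot A \<subseteq> L^G\<close>; this is \<open>reduced_groebner_basis_coeffs_fixed\<close>.

  \<^emph>\<open>Every invariant is a quotient of elements of A.\<close> Suppose that \<open>b \<in> L^G\<close> satisfies
  \<open>f(a) = b * g(a)\<close> with \<open>f\<close>, \<open>g\<close> over \<open>K\<close>. This relation is invariant, so \<open>f - b g\<close> vanishes on the
  whole orbit of \<open>a\<close> and lies in the Derksen ideal, hence in \<open>E\<close>
  (\<open>invariant_relation_in_derksen_ideal\<close>). Since the basis is monic with coefficients in \<open>A\<close>, division
  by it never leaves \<open>A\<close>, so \<open>f\<close> and \<open>g\<close> have normal forms \<open>f'\<close>, \<open>g'\<close> over \<open>A\<close>
  (\<open>normal_form_exists\<close>); \<open>f' - b g'\<close> lies in \<open>E\<close> without having a reducible monomial, so \<open>f' = b g'\<close>.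
  If \<open>g \<notin> E\<close>, then \<open>g' \<noteq> 0\<close> and comparing any nonzero coefficient of \<open>g'\<close> writes \<open>b\<close> as a quotient of
  elements of \<open>A\<close> (\<open>ratio_in_quot_field\<close>).

  \<^emph>\<open>Tameness provides such a g.\<close> The elements \<open>r\<close> of \<open>R\<close> with \<open>r b \<in> R\<close> form a nonzero \<open>G\<close>-stable
  set \<open>J\<close>. If every \<open>g\<close> over \<open>K\<close> with \<open>g(a) \<in> J\<close> belonged to \<open>E\<close>, then \<open>J\<close> would lie in the ideal \<open>I\<close>
  of values at \<open>a\<close> of polynomials in \<open>E\<close> over \<open>K\<close>, and by stability in all its conjugates. But their
  intersection is nilpotent, hence zero in a domain (\<open>invariant_fraction_denominator\<close>).

  Termination of the division is the well-foundedness of monomial orderings, which follows from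
  Dickson's lemma (\<open>dickson_subseq\<close>).
\<close>

section \<open>Type-class rings as rings with carrier\<close>

lemma type_ring_simps [simp]:
  "carrier type_ring = UNIV"
  "x \<otimes>\<^bsub>type_ring\<^esub> y = x * y"
  "x \<oplus>\<^bsub>type_ring\<^esub> y = x + y"
  "\<one>\<^bsub>type_ring\<^esub> = 1"
  "\<zero>\<^bsub>type_ring\<^esub> = 0"
  for x y :: "'a::comm_ring_1"
  by (simp_all add: ring_of_type_algebra_def)

lemma type_ring_a_inv [simp]: "\<ominus>\<^bsub>type_ring\<^esub> x = - x"
  for x :: "'a::comm_ring_1"
proof -
  interpret ring "type_ring :: 'a ring" by (rule ring_from_type_algebra)
  have "x \<oplus>\<^bsub>type_ring\<^esub> (- x) = \<zero>\<^bsub>type_ring\<^esub>" by simp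
  then show ?thesis
    using add.inv_equality[of "- x" x] by (simp add: a_inv_def)
qed

lemma type_ring_idealD:
  assumes "ideal E (type_ring :: 'a::comm_ring_1 ring)"
  shows "0 \<in> E" and "\<And>x y. x \<in> E \<Longrightarrow> y \<in> E \<Longrightarrow> x + y \<in> E"
    and "\<And>r x. x \<in> E \<Longrightarrow> r * x \<in> E"
    and "\<And>x y. x \<in> E \<Longrightarrow> y \<in> E \<Longrightarrow> x - y \<in> E"
proof -
  interpret ideal E "type_ring :: 'a ring" by fact
  show "0 \<in> E"
    using additive_subgroup.zero_closed[OF ideal.axioms(1)[OF assms]] by simp
  show add: "\<And>x y. x \<in> E \<Longrightarrow> y \<in> E \<Longrightarrow> x + y \<in> E"
    using additive_subgroup.a_closed[OF ideal.axioms(1)[OF assms]] by simp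
  show mult: "\<And>r x. x \<in> E \<Longrightarrow> r * x \<in> E" using I_l_closed by simp
  show "\<And>x y. x \<in> E \<Longrightarrow> y \<in> E \<Longrightarrow> x - y \<in> E"
    using add mult[of _ "-1"] by (metis diff_conv_add_uminus mult_minus1)
qed

lemma type_ring_idealI:
  fixes E :: "'a::comm_ring_1 set"
  assumes "0 \<in> E" and "\<And>x y. x \<in> E \<Longrightarrow> y \<in> E \<Longrightarrow> x + y \<in> E"
    and "\<And>r x. x \<in> E \<Longrightarrow> r * x \<in> E"
  shows "ideal E type_ring"
proof (rule idealI)
  show ring: "ring (type_ring :: 'a ring)" by (rule ring_from_type_algebra)
  interpret ring "type_ring :: 'a ring" by fact
  have "- x \<in> E" if "x \<in> E" for x
    using assms(3)[OF that, of "-1"] by simp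
  then have "\<ominus>\<^bsub>type_ring\<^esub> x \<in> E" if "x \<in> E" for x
    using that by simp
  then show "subgroup E (add_monoid type_ring)"
    using assms by (intro add.subgroupI) (auto simp: a_inv_def)
qed (use assms in \<open>auto simp: mult.commute\<close>)

lemma genideal_type_ring:
  fixes S :: "'a::comm_ring_1 set"
  shows genideal_type_ring_ideal: "ideal (Idl\<^bsub>type_ring\<^esub> S) type_ring"
    and genideal_type_ring_subset: "S \<subseteq> Idl\<^bsub>type_ring\<^esub> S"
    and genideal_type_ring_minimal: "ideal E type_ring \<Longrightarrow> S \<subseteq> E \<Longrightarrow> Idl\<^bsub>type_ring\<^esub> S \<subseteq> E"
proof -
  interpret ring "type_ring :: 'a ring" by (rule ring_from_type_algebra)
  show "ideal (Idl\<^bsub>type_ring\<^esub> S) type_ring" by (rule genideal_ideal) simp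
  show "S \<subseteq> Idl\<^bsub>type_ring\<^esub> S" by (rule genideal_self) simp
  show "ideal E type_ring \<Longrightarrow> S \<subseteq> E \<Longrightarrow> Idl\<^bsub>type_ring\<^esub> S \<subseteq> E" by (rule genideal_minimal)
qed

lemma subring_type_ringD:
  assumes "subring H (type_ring :: 'a::comm_ring_1 ring)"
  shows "0 \<in> H" and "1 \<in> H" and "\<And>x. x \<in> H \<Longrightarrow> - x \<in> H"
    and "\<And>x y. x \<in> H \<Longrightarrow> y \<in> H \<Longrightarrow> x + y \<in> H"
    and "\<And>x y. x \<in> H \<Longrightarrow> y \<in> H \<Longrightarrow> x * y \<in> H"
  using subringE[OF assms] by simp_all

lemma subring_type_ring_diff:
  assumes "subring H (type_ring :: 'a::comm_ring_1 ring)" "x \<in> H" "y \<in> H"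
  shows "x - y \<in> H"
  using subring_type_ringD(3,4)[OF assms(1)] assms(2,3) by (metis diff_conv_add_uminus)

lemma subring_type_ring_sum:
  assumes "subring H (type_ring :: 'a::comm_ring_1 ring)" "\<And>i. i \<in> S \<Longrightarrow> f i \<in> H"
  shows "(\<Sum>i\<in>S. f i) \<in> H"
  using assms(2) subring_type_ringD[OF assms(1)] by (induction S rule: infinite_finite_induct) auto

lemma subalgebra_gen_subring: "subring (subalgebra_gen K S) type_ring"
proof -
  interpret ring "type_ring :: 'a::field ring" by (rule ring_from_type_algebra)
  show ?thesis
    unfolding subalgebra_gen_def by (rule generate_ring_is_subring) simp
qed

lemma subalgebra_gen_superset: "K \<union> S \<subseteq> subalgebra_gen K S"
  unfolding subalgebra_gen_def by (auto intro: generate_ring.incl)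

lemma subalgebra_gen_minimal:
  assumes "subring H type_ring" and "K \<union> S \<subseteq> H"
  shows "subalgebra_gen K S \<subseteq> H"
proof
  fix x assume "x \<in> subalgebra_gen K S"
  then show "x \<in> H"
    unfolding subalgebra_gen_def
    by (induction rule: generate_ring.induct) (use assms(2) subring_type_ringD[OF assms(1)] in auto)
qed

text \<open>
  The \<open>k\<close>-th power of \<open>J\<close> contains \<open>x ^ k\<close> for every \<open>x \<in> J\<close>, and a field has no nilpotent element
  except \<open>0\<close>.
\<close>

lemma nilpotent_ideal_subset_0:
  fixes R J :: "'l::field set"
  assumes "1 \<in> R" and "nilpotent_ideal R J"
  shows "J \<subseteq> {0}"
proof
  fix x assume "x \<in> J"
  obtain k :: nat where k: "J [^]\<^bsub>ideals_set (type_ring\<lparr>carrier := R\<rparr>)\<^esub> k = {0}"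
    using assms(2) unfolding nilpotent_ideal_def by blast
  have "x ^ k \<in> J [^]\<^bsub>ideals_set (type_ring\<lparr>carrier := R\<rparr>)\<^esub> k" for k :: nat
  proof (induction k)
    case 0
    then show ?case using assms(1) by (simp add: nat_pow_def ideals_set_def)
  next
    case (Suc k)
    then show ?case
      using ideal_prod.prod[OF Suc \<open>x \<in> J\<close>, of "type_ring\<lparr>carrier := R\<rparr>"]
      by (simp add: nat_pow_def ideals_set_def mult.commute)
  qed
  then have "x ^ k \<in> {0}" using k by blast
  then show "x \<in> {0}" by simp
qed

section \<open>Evaluation of polynomials\<close>

lemma sum_single_keys:
  fixes f :: "'a \<Rightarrow>\<^sub>0 'b::comm_monoid_add"
  shows "(\<Sum>m\<in>Poly_Mapping.keys f. Poly_Mapping.single m (Poly_Mapping.lookup f m)) = f"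
  by (rule poly_mapping_eqI)
    (auto simp: lookup_sum lookup_single when_def in_keys_iff)

lemma mpoly_induct [case_names single add]:
  fixes f :: "'a \<Rightarrow>\<^sub>0 'b::comm_monoid_add"
  assumes "\<And>m c. P (Poly_Mapping.single m c)" and "\<And>f g. P f \<Longrightarrow> P g \<Longrightarrow> P (f + g)"
  shows "P f"
proof -
  (* The instance single undefined 0 = 0 is the empty sum. *)
  have "P (\<Sum>m\<in>S. Poly_Mapping.single m (Poly_Mapping.lookup f m))" for S
    using assms(1)[of undefined 0] assms by (induction S rule: infinite_finite_induct) auto
  then show ?thesis using sum_single_keys[of f] by metis
qed

definition monom_eval :: "('n::finite \<Rightarrow> 'l::field) \<Rightarrow> ('n \<Rightarrow>\<^sub>0 nat) \<Rightarrow> 'l"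
  where "monom_eval a m = (\<Prod>i\<in>UNIV. a i ^ Poly_Mapping.lookup m i)"

lemma monom_eval_add: "monom_eval a (m + n) = monom_eval a m * monom_eval a n"
  by (simp add: monom_eval_def lookup_add power_add prod.distrib)

lemma poly_eval_superset:
  assumes "finite S" and "Poly_Mapping.keys f \<subseteq> S"
  shows "poly_eval a f = (\<Sum>m\<in>S. Poly_Mapping.lookup f m * monom_eval a m)"
  unfolding poly_eval_def monom_eval_def
  using assms by (intro sum.mono_neutral_left) (auto simp: in_keys_iff)

lemma poly_eval_single [simp]: "poly_eval a (Poly_Mapping.single m c) = c * monom_eval a m"
  by (subst poly_eval_superset[of "{m}"]) (auto simp: lookup_single)

lemma poly_eval_add: "poly_eval a (f + g) = poly_eval a f + poly_eval a g"
proof -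
  have fin: "finite (Poly_Mapping.keys f \<union> Poly_Mapping.keys g)" by simp
  show ?thesis
    by (simp add: poly_eval_superset[OF fin] keys_add lookup_add distrib_right sum.distrib)
qed

lemma poly_eval_mult: "poly_eval a (f * g) = poly_eval a f * poly_eval a g"
proof (induction f rule: mpoly_induct)
  case (single m c)
  show ?case
    by (induction g rule: mpoly_induct)
      (simp_all add: mult_single monom_eval_add poly_eval_add algebra_simps)
qed (simp add: poly_eval_add algebra_simps)

lemma poly_eval_Const [simp]: "poly_eval a (Const c) = c"
  by (simp add: Const_def monom_eval_def)

lemma poly_eval_uminus: "poly_eval a (- f) = - poly_eval a f"
  using poly_eval_add[of a f "- f"] poly_eval_Const[of a 0] by (simp add: Const_def eq_neg_iff_add_eq_0 add.commute)

lemma poly_eval_diff: "poly_eval a (f - g) = poly_eval a f - poly_eval a g"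
  using poly_eval_add[of a f "- g"] by (simp add: poly_eval_uminus)

lemma poly_eval_Var [simp]: "poly_eval a (Var i) = a i"
proof -
  have "monom_eval a (Poly_Mapping.single i 1) = (\<Prod>j\<in>UNIV. if j = i then a i else 1)"
    unfolding monom_eval_def by (intro prod.cong) (auto simp: lookup_single when_def)
  then show ?thesis by (simp add: Var_def)
qed

lemma Const_mult: "Const (c * d) = Const c * Const d"
  by (simp add: Const_def mult_single)

lemma Const_add: "Const (c + d) = Const c + Const d"
  by (simp add: Const_def single_add)

lemma Const_1: "Const 1 = 1"
  by (simp add: Const_def)

lemma single_eq_Const_mult_prod_Var:
  "Poly_Mapping.single m c = Const c * (\<Prod>i\<in>UNIV. Var i ^ Poly_Mapping.lookup m i)"
  for m :: "'n::finite \<Rightarrow>\<^sub>0 nat"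
proof -
  have power: "Var i ^ k = (Poly_Mapping.single (Poly_Mapping.single i k) 1 :: ('n, 'a) mpoly)" for i :: 'n and k
    by (induction k) (simp_all add: Var_def mult_single flip: single_add)
  have "(\<Prod>i\<in>S. Var i ^ Poly_Mapping.lookup m i) =
      (Poly_Mapping.single (\<Sum>i\<in>S. Poly_Mapping.single i (Poly_Mapping.lookup m i)) 1 :: ('n, 'a) mpoly)"
    if "finite S" for S
    using that by (induction S) (simp_all add: power mult_single)
  moreover have "(\<Sum>i\<in>UNIV. Poly_Mapping.single i (Poly_Mapping.lookup m i)) = m"
    by (rule poly_mapping_eqI) (simp add: lookup_sum lookup_single when_def)
  ultimately show ?thesis by (simp add: Const_def mult_single)
qed

text \<open>
  Modulo \<open>y_i - c_i\<close> every polynomial is congruent to its value at \<open>c\<close>: this is clear for constants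
  and indeterminates, and it is inherited by sums and products.
\<close>

lemma vanishing_in_point_ideal:
  fixes c :: "'n::finite \<Rightarrow> 'l::field"
  assumes "poly_eval c f = 0"
  shows "f \<in> Idl\<^bsub>type_ring\<^esub> (range (\<lambda>i. Var i - Const (c i)))" (is "_ \<in> ?M")
proof -
  note M = type_ring_idealD[OF genideal_type_ring_ideal[of "range (\<lambda>i. Var i - Const (c i) :: ('n, 'l) mpoly)"]]
  define Q where "Q f \<longleftrightarrow> f - Const (poly_eval c f) \<in> ?M" for f
  have QVar: "Q (Var i)" for i
    using genideal_type_ring_subset by (fastforce simp: Q_def)
  have QConst: "Q (Const d)" for d
    using M(1) by (simp add: Q_def)
  have Qadd: "Q (f + g)" if "Q f" "Q g" for f g
    using M(2)[OF that[unfolded Q_def]] by (simp add: Q_def poly_eval_add Const_add algebra_simps)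
  have Qmult: "Q (f * g)" if "Q f" "Q g" for f g
  proof -
    have "f * (g - Const (poly_eval c g)) + Const (poly_eval c g) * (f - Const (poly_eval c f)) \<in> ?M"
      using that by (intro M(2,3)) (simp_all add: Q_def)
    then show ?thesis by (simp add: Q_def poly_eval_mult Const_mult algebra_simps)
  qed
  have Qpow: "Q (Var i ^ k)" for i k
    by (induction k) (use Qmult QVar QConst[of 1] in \<open>auto simp: Const_1\<close>)
  have Qprod: "Q (\<Prod>i\<in>S. Var i ^ e i)" for S e
    by (induction S rule: infinite_finite_induct) (use Qmult Qpow QConst[of 1] in \<open>auto simp: Const_1\<close>)
  have "Q f"
    by (induction f rule: mpoly_induct)
      (auto simp: single_eq_Const_mult_prod_Var intro: Qadd Qmult QConst Qprod)
  then show ?thesis using assms by (simp add: Q_def Const_def)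
qed

section \<open>Polynomials with coefficients in a subring\<close>

lemma polys_over_iff: "f \<in> polys_over H \<longleftrightarrow> (\<forall>m. Poly_Mapping.lookup f m \<in> H)"
  by (auto simp: polys_over_def)

lemma polys_over_single:
  assumes "0 \<in> H" and "c \<in> H" shows "Poly_Mapping.single m c \<in> polys_over H"
  using assms by (auto simp: polys_over_iff lookup_single when_def)

context
  fixes H :: "'l::field set"
  assumes H: "subring H type_ring"
begin

lemma polys_over_Const: "c \<in> H \<Longrightarrow> Const c \<in> polys_over H"
  using subring_type_ringD(1)[OF H] by (simp add: Const_def polys_over_single)

lemma polys_over_Var: "Var i \<in> polys_over H"
  using subring_type_ringD(1,2)[OF H] unfolding Var_def by (rule polys_over_single)

lemma polys_over_add: "f \<in> polys_over H \<Longrightarrow> g \<in> polys_over H \<Longrightarrow> f + g \<in> polys_over H"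
  using subring_type_ringD[OF H] by (simp add: polys_over_iff lookup_add)

lemma polys_over_uminus: "f \<in> polys_over H \<Longrightarrow> - f \<in> polys_over H"
  using subring_type_ringD[OF H] by (simp add: polys_over_iff)

lemma polys_over_diff: "f \<in> polys_over H \<Longrightarrow> g \<in> polys_over H \<Longrightarrow> f - g \<in> polys_over H"
  using subring_type_ring_diff[OF H] by (simp add: polys_over_iff lookup_minus)

lemma polys_over_mult:
  assumes "f \<in> polys_over H" "g \<in> polys_over H"
  shows "f * g \<in> polys_over H"
proof -
  have "(\<Sum>q. Poly_Mapping.lookup g q when k = l + q) \<in> H" for k l
    using assms subring_type_ringD[OF H]
    by (auto simp: Sum_any.expand_set polys_over_iff when_def intro!: subring_type_ring_sum[OF H])
  then show ?thesis
    using assms subring_type_ringD[OF H]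
    by (auto simp: polys_over_iff lookup_mult Sum_any.expand_set intro!: subring_type_ring_sum[OF H])
qed

lemma polys_over_sum: "(\<And>i. i \<in> S \<Longrightarrow> f i \<in> polys_over H) \<Longrightarrow> (\<Sum>i\<in>S. f i) \<in> polys_over H"
  by (auto simp: polys_over_iff lookup_sum intro!: subring_type_ring_sum[OF H])

lemma subalgebra_gen_subset_poly_eval:
  "subalgebra_gen H (range a) \<subseteq> poly_eval a ` polys_over H"
proof
  fix x assume "x \<in> subalgebra_gen H (range a)"
  then have "\<exists>f\<in>polys_over H. poly_eval a f = x"
    unfolding subalgebra_gen_def
  proof (induction rule: generate_ring.induct)
    case one
    show ?case using polys_over_Const[of 1] subring_type_ringD(2)[OF H] by force
  next
    case (incl h)
    then show ?case
      using polys_over_Const[of h] polys_over_Var by force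
  next
    case (a_inv h)
    then obtain f where "f \<in> polys_over H" "poly_eval a f = h" by blast
    then show ?case
      using polys_over_uminus by (intro bexI[of _ "- f"]) (simp_all add: poly_eval_uminus)
  next
    case (eng_add h1 h2)
    then obtain f g where "f \<in> polys_over H" "poly_eval a f = h1" "g \<in> polys_over H" "poly_eval a g = h2"
      by blast
    then show ?case
      using polys_over_add by (intro bexI[of _ "f + g"]) (simp_all add: poly_eval_add)
  next
    case (eng_mult h1 h2)
    then obtain f g where "f \<in> polys_over H" "poly_eval a f = h1" "g \<in> polys_over H" "poly_eval a g = h2"
      by blast
    then show ?case
      using polys_over_mult by (intro bexI[of _ "f * g"]) (simp_all add: poly_eval_mult)
  qed
  then show "x \<in> poly_eval a ` polys_over H" by blast
qed

end

section \<open>Monomial orderings are well-founded\<close>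

lemma nat_seq_incseq_subseq:
  fixes s :: "nat \<Rightarrow> nat"
  shows "\<exists>r. strict_mono r \<and> incseq (\<lambda>k. s (r k))"
proof -
  obtain r :: "nat \<Rightarrow> nat" where r: "strict_mono r" "monoseq (\<lambda>k. s (r k))"
    using seq_monosub by blast
  show ?thesis
  proof (cases "incseq (\<lambda>k. s (r k))")
    case False
    then have dec: "decseq (\<lambda>k. s (r k))" using r(2) by (simp add: monoseq_iff)
    (* A decreasing sequence of naturals is constant from the point where it takes its least value. *)
    obtain N where N: "\<And>k. s (r N) \<le> s (r k)"
      using ex_has_least_nat[of "\<lambda>_. True" 0 "\<lambda>k. s (r k)"] by blast
    have "s (r (N + k)) = s (r N)" for k
      using N[of "N + k"] decseqD[OF dec, of N "N + k"] by simp
    moreover have "strict_mono (\<lambda>k. r (N + k))"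
      using r(1) by (simp add: strict_mono_def)
    ultimately show ?thesis by (intro exI[of _ "\<lambda>k. r (N + k)"]) (simp add: incseq_def)
  qed (use r in blast)
qed

text \<open>
  Dickson's lemma for sequences: refine to a subsequence once for every coordinate.
\<close>

lemma dickson_subseq:
  fixes s :: "nat \<Rightarrow> 'i \<Rightarrow> nat"
  assumes "finite S"
  shows "\<exists>r. strict_mono r \<and> (\<forall>i\<in>S. incseq (\<lambda>k. s (r k) i))"
  using assms
proof (induction S)
  case empty
  show ?case using strict_mono_id by blast
next
  case (insert i S)
  obtain r where r: "strict_mono r" "\<forall>i\<in>S. incseq (\<lambda>k. s (r k) i)" using insert.IH by blast
  obtain q where q: "strict_mono q" "incseq (\<lambda>k. s (r (q k)) i)"
    using nat_seq_incseq_subseq[of "\<lambda>k. s (r k) i"] by blast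
  have "incseq (\<lambda>k. s (r (q k)) j)" if "j \<in> S" for j
    using r(2) that strict_mono_mono[OF q(1)] by (force simp: incseq_def dest: monoD)
  moreover have "strict_mono (r \<circ> q)" using r(1) q(1) by (rule strict_mono_o)
  ultimately show ?case using q(2) by (intro exI[of _ "r \<circ> q"]) (auto simp: o_def)
qed

locale monomial_order =
  fixes mle :: "('n::finite \<Rightarrow>\<^sub>0 nat) \<Rightarrow> ('n \<Rightarrow>\<^sub>0 nat) \<Rightarrow> bool"
  assumes monomial_ordering: "monomial_ordering mle"
begin

lemma mle_refl: "mle s s"
  and mle_trans: "mle s t \<Longrightarrow> mle t u \<Longrightarrow> mle s u"
  and mle_antisym: "mle s t \<Longrightarrow> mle t s \<Longrightarrow> s = t"
  and mle_total: "mle s t \<or> mle t s"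
  and mle_add: "mle s t \<Longrightarrow> mle (s + u) (t + u)"
  and mle_add_right: "mle s (s + u)"
proof -
  note lo = monomial_ordering[unfolded monomial_ordering_def linear_order_on_def partial_order_on_def preorder_on_def]
  show refl: "mle s s" for s using lo by (auto simp: refl_on_def)
  show "mle s t \<Longrightarrow> mle t u \<Longrightarrow> mle s u" using lo by (auto dest: transD)
  show "mle s t \<Longrightarrow> mle t s \<Longrightarrow> s = t" using lo by (auto dest: antisymD)
  show "mle s t \<or> mle t s" using lo refl by (cases "s = t") (auto simp: total_on_def)
  show "mle s t \<Longrightarrow> mle (s + u) (t + u)" using lo by blast
  have "mle (0 + s) (u + s)" using lo by blast
  then show "mle s (s + u)" by (simp add: add.commute)
qed

text \<open>
  In a strictly descending sequence of monomials, Dickson's lemma finds an earlier one that divides a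
  later one and is therefore below it in the ordering.
\<close>

lemma wf_mle: "wf {(s, t). mle s t \<and> s \<noteq> t}"
proof (rule ccontr)
  assume "\<not> ?thesis"
  then obtain f where f: "\<And>k. mle (f (Suc k)) (f k)" "\<And>k. f (Suc k) \<noteq> f k"
    by (auto simp: wf_iff_no_infinite_down_chain)
  obtain r :: "nat \<Rightarrow> nat" where r: "strict_mono r" "\<forall>i\<in>UNIV. incseq (\<lambda>k. Poly_Mapping.lookup (f (r k)) i)"
    using dickson_subseq[of UNIV "\<lambda>k. Poly_Mapping.lookup (f k)"] by auto
  have dec: "mle (f j) (f i)" if "i \<le> j" for i j
    using that by (induction j rule: dec_induct) (auto intro: mle_refl mle_trans f(1))
  define u where "u = f (r 1) - f (r 0)"
  have "Poly_Mapping.lookup (f (r 0)) i \<le> Poly_Mapping.lookup (f (r 1)) i" for i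
    using r(2) by (auto simp: incseq_def)
  then have "f (r 1) = f (r 0) + u"
    by (intro poly_mapping_eqI) (simp add: u_def lookup_add lookup_minus)
  then have "mle (f (r 0)) (f (r 1))" using mle_add_right by metis
  moreover have "Suc (r 0) \<le> r 1" using r(1) by (simp add: strict_mono_def Suc_leI)
  ultimately have "mle (f (r 0)) (f (Suc (r 0)))" using dec mle_trans by blast
  then show False using f mle_antisym by blast
qed

lemma lead_monom:
  assumes "f \<noteq> 0"
  shows lead_monom_in_keys: "lead_monom mle f \<in> Poly_Mapping.keys f"
    and lead_monom_max: "t \<in> Poly_Mapping.keys f \<Longrightarrow> mle t (lead_monom mle f)"
proof -
  have "\<exists>m\<in>S. \<forall>t\<in>S. mle t m" if "finite S" "S \<noteq> {}" for S
    using that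
  proof (induction S rule: finite_ne_induct)
    case (singleton x)
    then show ?case using mle_refl by simp
  next
    case (insert x S)
    then obtain m where m: "m \<in> S" "\<forall>t\<in>S. mle t m" by blast
    show ?case
    proof (cases "mle x m")
      case True
      then show ?thesis using m by blast
    next
      case False
      then have "mle m x" using mle_total by blast
      then have "\<forall>t\<in>insert x S. mle t x" using m mle_trans mle_refl by blast
      then show ?thesis by blast
    qed
  qed
  then have "\<exists>m\<in>Poly_Mapping.keys f. \<forall>t\<in>Poly_Mapping.keys f. mle t m"
    using assms by simp
  then have "\<exists>!m. m \<in> Poly_Mapping.keys f \<and> (\<forall>t\<in>Poly_Mapping.keys f. mle t m)"
    using mle_antisym by blast
  from theI'[OF this, folded lead_monom_def]
  show "lead_monom mle f \<in> Poly_Mapping.keys f"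
    and "t \<in> Poly_Mapping.keys f \<Longrightarrow> mle t (lead_monom mle f)"
    by simp_all
qed

end

section \<open>Normal forms modulo a Groebner basis\<close>

lemma lookup_single_mult:
  "Poly_Mapping.lookup (Poly_Mapping.single u c * h) (u + k) = c * Poly_Mapping.lookup h k"
  for h :: "('n, 'l::field) mpoly"
proof (induction h rule: mpoly_induct)
  case (single m d)
  then show ?case by (simp add: mult_single lookup_single when_def)
next
  case (add f g)
  then show ?case by (simp add: lookup_add distrib_left)
qed

lemma lookup_Const_mult: "Poly_Mapping.lookup (Const c * h) k = c * Poly_Mapping.lookup h k"
  using lookup_single_mult[of 0 c h k] by (simp add: Const_def)

text \<open>
  The zero polynomial is excluded since its \<open>lead_monom\<close> is an arbitrary value.
\<close>

definition monom_reducible ::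
    "(('n \<Rightarrow>\<^sub>0 nat) \<Rightarrow> ('n \<Rightarrow>\<^sub>0 nat) \<Rightarrow> bool) \<Rightarrow> ('n, 'l::field) mpoly set \<Rightarrow> ('n \<Rightarrow>\<^sub>0 nat) \<Rightarrow> bool"
  where "monom_reducible mle B t \<longleftrightarrow> (\<exists>h\<in>B - {0}. \<exists>u. t = lead_monom mle h + u)"

definition has_normal_form ::
    "(('n \<Rightarrow>\<^sub>0 nat) \<Rightarrow> ('n \<Rightarrow>\<^sub>0 nat) \<Rightarrow> bool) \<Rightarrow> ('n, 'l::field) mpoly set \<Rightarrow> 'l set \<Rightarrow>
      ('n, 'l) mpoly set \<Rightarrow> ('n, 'l) mpoly \<Rightarrow> bool"
  where "has_normal_form mle B A E f \<longleftrightarrow>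
    (\<exists>f'\<in>polys_over A. f - f' \<in> E \<and> (\<forall>t\<in>Poly_Mapping.keys f'. \<not> monom_reducible mle B t))"

text \<open>
  The leading ideal of \<open>B\<close> is a monomial ideal: the polynomials all of whose monomials are reducible
  form an ideal containing its generators. As it is also the leading ideal of \<open>E\<close>, it contains the
  leading monomial of \<open>f\<close>.
\<close>

lemma groebner_basis_reducible:
  fixes E B :: "('n::finite, 'l::field) mpoly set"
  assumes "groebner_basis mle E B" and "f \<in> E" and "f \<noteq> 0"
  shows "monom_reducible mle B (lead_monom mle f)"
proof -
  define D :: "('n, 'l) mpoly set" where "D = {p. \<forall>t\<in>Poly_Mapping.keys p. monom_reducible mle B t}"
  have "monom_reducible mle B (s + t)" if red: "monom_reducible mle B t" for s t
  proof -
    obtain h u where h: "h \<in> B - {0}" and t: "t = lead_monom mle h + u"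
      using red unfolding monom_reducible_def by blast
    have "s + t = lead_monom mle h + (s + u)" by (simp add: t ac_simps)
    then show ?thesis using h unfolding monom_reducible_def by blast
  qed
  then have mult: "r * p \<in> D" if "p \<in> D" for r p
    using that keys_mult[of r p] unfolding D_def by blast
  have "ideal D type_ring"
  proof (rule type_ring_idealI)
    show "p + q \<in> D" if "p \<in> D" "q \<in> D" for p q
      using that keys_add[of p q] by (auto simp: D_def)
  qed (use mult in \<open>auto simp: D_def\<close>)
  moreover have "(\<lambda>f. Poly_Mapping.single (lead_monom mle f) 1) ` (B - {0}) \<subseteq> D"
  proof
    fix p :: "('n, 'l) mpoly"
    assume "p \<in> (\<lambda>f. Poly_Mapping.single (lead_monom mle f) 1) ` (B - {0})"
    then obtain h where h: "h \<in> B - {0}" "p = Poly_Mapping.single (lead_monom mle h) 1" by blast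
    have "lead_monom mle h = lead_monom mle h + 0" by simp
    then have "monom_reducible mle B (lead_monom mle h)"
      using h(1) unfolding monom_reducible_def by blast
    then show "p \<in> D" by (simp add: D_def h(2))
  qed
  ultimately have "lead_ideal mle B \<subseteq> D"
    unfolding lead_ideal_def by (rule genideal_type_ring_minimal)
  moreover have "Poly_Mapping.single (lead_monom mle f) 1 \<in> lead_ideal mle E"
    unfolding lead_ideal_def using assms(2,3) by (intro subsetD[OF genideal_type_ring_subset] imageI) simp
  ultimately show ?thesis
    using assms(1) by (auto simp: groebner_basis_def D_def)
qed

context monomial_order
begin

lemma irreducible_in_ideal_0:
  assumes "groebner_basis mle E B" and "f \<in> E"
    and "\<And>t. t \<in> Poly_Mapping.keys f \<Longrightarrow> \<not> monom_reducible mle B t"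
  shows "f = 0"
  using groebner_basis_reducible[OF assms(1,2)] assms(3) lead_monom_in_keys by blast

text \<open>
  Division with remainder. Remainders are linear in the dividend, so it is enough to divide
  monomials, by induction along the ordering. A reducible monomial is \<open>u * lm h\<close> with \<open>h\<close> in \<open>B\<close>, and
  subtracting \<open>u * h\<close> from it leaves only smaller monomials. As \<open>h\<close> is monic, no division of
  coefficients occurs, and they remain in the subring \<open>A\<close>.
\<close>

lemma normal_form_exists:
  assumes A: "subring A type_ring" and E: "ideal E type_ring"
    and "B \<subseteq> E" and "B \<subseteq> polys_over A"
    and monic: "\<And>g. g \<in> B \<Longrightarrow> Poly_Mapping.lookup g (lead_monom mle g) = 1"
    and "f \<in> polys_over A"
  shows "has_normal_form mle B A E f"
proof -
  note A0 = subring_type_ringD(1)[OF A] and A1 = subring_type_ringD(2)[OF A] and E = type_ring_idealD[OF E]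
  have linear: "has_normal_form mle B A E p"
    if p: "p \<in> polys_over A"
      and monoms: "\<And>t. t \<in> Poly_Mapping.keys p \<Longrightarrow> has_normal_form mle B A E (Poly_Mapping.single t 1)" for p
  proof -
    obtain n where n: "\<And>t. t \<in> Poly_Mapping.keys p \<Longrightarrow> n t \<in> polys_over A"
      "\<And>t. t \<in> Poly_Mapping.keys p \<Longrightarrow> Poly_Mapping.single t 1 - n t \<in> E"
      "\<And>t s. t \<in> Poly_Mapping.keys p \<Longrightarrow> s \<in> Poly_Mapping.keys (n t) \<Longrightarrow> \<not> monom_reducible mle B s"
      using monoms unfolding has_normal_form_def by metis
    define p' where "p' = (\<Sum>t\<in>Poly_Mapping.keys p. Const (Poly_Mapping.lookup p t) * n t)"
    have "p' \<in> polys_over A"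
      unfolding p'_def using p n(1)
      by (intro polys_over_sum[OF A] polys_over_mult[OF A] polys_over_Const[OF A]) (auto simp: polys_over_iff)
    moreover have "p - p' \<in> E"
    proof -
      have sum_E: "(\<Sum>t\<in>S. q t) \<in> E" if "\<And>t. t \<in> S \<Longrightarrow> q t \<in> E" for q and S :: "('n \<Rightarrow>\<^sub>0 nat) set"
        using that E by (induction S rule: infinite_finite_induct) auto
      have "p = (\<Sum>t\<in>Poly_Mapping.keys p. Const (Poly_Mapping.lookup p t) * Poly_Mapping.single t 1)"
        using sum_single_keys[of p] by (simp add: Const_def mult_single)
      then have "p - p' = (\<Sum>t\<in>Poly_Mapping.keys p. Const (Poly_Mapping.lookup p t) * (Poly_Mapping.single t 1 - n t))"
        by (simp add: p'_def sum_subtractf right_diff_distrib)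
      then show ?thesis using sum_E[OF E(3)[OF n(2)]] by simp
    qed
    moreover have "\<not> monom_reducible mle B s" if "s \<in> Poly_Mapping.keys p'" for s
    proof -
      have "\<exists>t\<in>Poly_Mapping.keys p. s \<in> Poly_Mapping.keys (n t)"
      proof (rule ccontr)
        assume "\<not> ?thesis"
        then have "Poly_Mapping.lookup p' s = 0"
          by (simp add: p'_def lookup_sum lookup_Const_mult in_keys_iff)
        then show False using that by (simp add: in_keys_iff)
      qed
      then show ?thesis using n(3) by blast
    qed
    ultimately show ?thesis unfolding has_normal_form_def by blast
  qed
  have "has_normal_form mle B A E (Poly_Mapping.single t 1)" for t
  proof (induction t rule: wf_induct[OF wf_mle])
    case (1 t)
    show ?case
    proof (cases "monom_reducible mle B t")
      case False
      then show ?thesis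
        unfolding has_normal_form_def using E(1) polys_over_single[OF A0 A1, of t]
        by (intro bexI[of _ "Poly_Mapping.single t 1"]) auto
    next
      case True
      then obtain h u where h: "h \<in> B" "h \<noteq> 0" and t: "t = u + lead_monom mle h"
        unfolding monom_reducible_def by (auto simp: add.commute)
      define p where "p = Poly_Mapping.single t 1 - Poly_Mapping.single u 1 * h"
      have "p \<in> polys_over A"
        unfolding p_def using assms(4) h
        by (intro polys_over_diff[OF A] polys_over_mult[OF A] polys_over_single A0 A1) auto
      moreover have "has_normal_form mle B A E (Poly_Mapping.single s 1)" if s: "s \<in> Poly_Mapping.keys p" for s
      proof -
        have "Poly_Mapping.lookup p t = 0"
          using monic[OF h(1)] by (simp add: p_def lookup_minus t lookup_single_mult)
        then have "s \<noteq> t" using s by (auto simp: in_keys_iff)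
        then have "s \<in> Poly_Mapping.keys (Poly_Mapping.single u 1 * h)"
          using s by (auto simp: p_def in_keys_iff lookup_minus lookup_single when_def split: if_splits)
        then obtain k where "s = u + k" "k \<in> Poly_Mapping.keys h"
          using keys_mult[of "Poly_Mapping.single u 1" h] by (auto split: if_splits)
        then have "mle s t"
          using mle_add[OF lead_monom_max[OF h(2)], of k u] by (simp add: t add.commute)
        then show ?thesis using 1 \<open>s \<noteq> t\<close> by blast
      qed
      ultimately obtain p' where p': "p' \<in> polys_over A" "p - p' \<in> E"
        "\<forall>s\<in>Poly_Mapping.keys p'. \<not> monom_reducible mle B s"
        using linear unfolding has_normal_form_def by blast
      have "(p - p') + Poly_Mapping.single u 1 * h \<in> E"
        using p'(2) h(1) assms(3) by (intro E(2,3)) auto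
      then have "Poly_Mapping.single t 1 - p' \<in> E" by (simp add: p_def)
      then show ?thesis using p' unfolding has_normal_form_def by blast
    qed
  qed
  then show ?thesis using linear assms(6) by blast
qed

text \<open>
  A congruence \<open>f = b * g\<close> modulo \<open>E\<close> becomes an equation between normal forms, because no nonzero
  element of \<open>E\<close> consists of irreducible monomials only; the condition \<open>g \<notin> E\<close> says that the normal
  form of \<open>g\<close> has a coefficient to divide by.
\<close>

lemma ratio_in_quot_field:
  assumes A: "subring A type_ring" and E: "ideal E type_ring"
    and gb: "groebner_basis mle E B" and "B \<subseteq> polys_over A"
    and monic: "\<And>g. g \<in> B \<Longrightarrow> Poly_Mapping.lookup g (lead_monom mle g) = 1"
    and f: "f \<in> polys_over A" and g: "g \<in> polys_over A" "g \<notin> E"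
    and fg: "f - Const b * g \<in> E"
  shows "b \<in> quot_field A"
proof -
  have BE: "B \<subseteq> E" using gb by (simp add: groebner_basis_def)
  note nf = normal_form_exists[OF A E BE assms(4) monic, unfolded has_normal_form_def]
  note E' = type_ring_idealD[OF E]
  obtain f' where f': "f' \<in> polys_over A" "f - f' \<in> E" "\<forall>t\<in>Poly_Mapping.keys f'. \<not> monom_reducible mle B t"
    using nf[OF _ f] by blast
  obtain g' where g': "g' \<in> polys_over A" "g - g' \<in> E" "\<forall>t\<in>Poly_Mapping.keys g'. \<not> monom_reducible mle B t"
    using nf[OF _ g(1)] by blast
  have "(f - Const b * g) - (f - f') + Const b * (g - g') \<in> E"
    using E'(2)[OF E'(4)[OF fg f'(2)] E'(3)[OF g'(2)]] .
  then have "f' - Const b * g' \<in> E" by (simp add: algebra_simps)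
  moreover have "\<not> monom_reducible mle B t" if "t \<in> Poly_Mapping.keys (f' - Const b * g')" for t
    using that f'(3) g'(3) by (auto simp: in_keys_iff lookup_minus lookup_Const_mult)
  ultimately have "f' - Const b * g' = 0" by (rule irreducible_in_ideal_0[OF gb])
  then have coeff: "Poly_Mapping.lookup f' t = b * Poly_Mapping.lookup g' t" for t
    using lookup_Const_mult[of b g' t] by simp
  have "g' \<noteq> 0" using g(2) g'(2) by auto
  then obtain t where t: "Poly_Mapping.lookup g' t \<noteq> 0" by (metis lookup_zero poly_mapping_eqI)
  then have "b = Poly_Mapping.lookup f' t / Poly_Mapping.lookup g' t" by (simp add: coeff)
  then show ?thesis
    unfolding quot_field_def using f'(1) g'(1) t by (auto simp: polys_over_iff)
qed

end

section \<open>Groups acting by field automorphisms\<close>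

locale field_action =
  fixes G :: "('g, 'm) monoid_scheme" and act :: "'g \<Rightarrow> 'l::field \<Rightarrow> 'l"
  assumes acts_by_automorphisms: "acts_by_automorphisms G act"
begin

sublocale group_action G UNIV act
  using acts_by_automorphisms by (simp add: acts_by_automorphisms_def)

lemma act_one [simp]: "act \<one>\<^bsub>G\<^esub> x = x"
  using fun_cong[OF id_eq_one, of x] by simp

lemma
  assumes "\<sigma> \<in> carrier G"
  shows act_add: "act \<sigma> (x + y) = act \<sigma> x + act \<sigma> y"
    and act_mult: "act \<sigma> (x * y) = act \<sigma> x * act \<sigma> y"
    and act_1: "act \<sigma> 1 = 1"
proof -
  have "act \<sigma> \<in> ring_hom type_ring type_ring"
    using acts_by_automorphisms assms by (simp add: acts_by_automorphisms_def ring_iso_def)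
  from ring_hom_add[OF this, of x y] ring_hom_mult[OF this, of x y] ring_hom_one[OF this]
  show "act \<sigma> (x + y) = act \<sigma> x + act \<sigma> y" "act \<sigma> (x * y) = act \<sigma> x * act \<sigma> y" "act \<sigma> 1 = 1"
    by simp_all
qed

lemma act_0: assumes "\<sigma> \<in> carrier G" shows "act \<sigma> 0 = 0"
proof -
  have "act \<sigma> 0 + act \<sigma> 0 = act \<sigma> 0 + 0"
    unfolding act_add[OF assms, symmetric] by simp
  then show ?thesis unfolding add_left_cancel .
qed

lemma act_uminus: assumes "\<sigma> \<in> carrier G" shows "act \<sigma> (- x) = - act \<sigma> x"
proof -
  have "act \<sigma> x + act \<sigma> (- x) = 0"
    unfolding act_add[OF assms, symmetric] by (simp add: act_0 assms)
  then show ?thesis by (rule minus_unique[symmetric])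
qed

lemma act_power: "\<sigma> \<in> carrier G \<Longrightarrow> act \<sigma> (x ^ k) = act \<sigma> x ^ k"
  by (induction k) (simp_all add: act_1 act_mult)

lemma act_sum: "\<sigma> \<in> carrier G \<Longrightarrow> act \<sigma> (\<Sum>i\<in>S. f i) = (\<Sum>i\<in>S. act \<sigma> (f i))"
  by (induction S rule: infinite_finite_induct) (simp_all add: act_0 act_add)

lemma act_prod: "\<sigma> \<in> carrier G \<Longrightarrow> act \<sigma> (\<Prod>i\<in>S. f i) = (\<Prod>i\<in>S. act \<sigma> (f i))"
  by (induction S rule: infinite_finite_induct) (simp_all add: act_1 act_mult)

lemma act_divide: assumes "\<sigma> \<in> carrier G" shows "act \<sigma> (x / y) = act \<sigma> x / act \<sigma> y"
proof (cases "y = 0")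
  case True
  then show ?thesis using assms by (simp add: act_0)
next
  case False
  have "act \<sigma> y * act \<sigma> (inverse y) = 1"
    unfolding act_mult[OF assms, symmetric] using False by (simp add: act_1 assms)
  then have "act \<sigma> y \<noteq> 0" by auto
  moreover have "act \<sigma> (x / y) * act \<sigma> y = act \<sigma> x"
    unfolding act_mult[OF assms, symmetric] using False by simp
  ultimately show ?thesis by (rule eq_divide_imp)
qed

lemma fixed_field_subring: "subring (fixed_field G act) type_ring"
proof -
  interpret R: ring "type_ring :: 'l ring" by (rule ring_from_type_algebra)
  show ?thesis
    by (rule R.subringI) (auto simp: fixed_field_def act_1 act_uminus act_add act_mult)
qed

lemma quot_field_fixed: "A \<subseteq> fixed_field G act \<Longrightarrow> quot_field A \<subseteq> fixed_field G act"
proof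
  fix z assume A: "A \<subseteq> fixed_field G act" and "z \<in> quot_field A"
  then obtain x y where z: "z = x / y" and "x \<in> A" "y \<in> A" unfolding quot_field_def by blast
  then have "x \<in> fixed_field G act" "y \<in> fixed_field G act" using A by auto
  then show "z \<in> fixed_field G act" by (simp add: z fixed_field_def act_divide)
qed

lemma poly_eval_act:
  assumes "\<sigma> \<in> carrier G" and "f \<in> polys_over (fixed_field G act)"
  shows "poly_eval (\<lambda>i. act \<sigma> (a i)) f = act \<sigma> (poly_eval a f)"
  using assms(2)
  by (simp add: poly_eval_def act_sum act_prod act_mult act_power assms(1) polys_over_iff fixed_field_def)

lemma lookup_map_act:
  "\<sigma> \<in> carrier G \<Longrightarrow> Poly_Mapping.lookup (Poly_Mapping.map (act \<sigma>) f) k = act \<sigma> (Poly_Mapping.lookup f k)"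
  by (simp add: Poly_Mapping.map.rep_eq when_def act_0)

text \<open>
  Otherwise \<open>d = \<sigma> g - g\<close> is a nonzero element of \<open>E\<close> whose leading monomial occurs in \<open>g\<close> and is
  reducible. By reducedness only \<open>g\<close> itself can reduce it, so it is the leading monomial of \<open>g\<close>;
  but there \<open>g\<close> has the coefficient \<open>1\<close>, which cancels in \<open>d\<close>.
\<close>

lemma reduced_groebner_basis_coeffs_fixed:
  fixes E B :: "('n::finite, 'l) mpoly set"
  assumes mle: "monomial_ordering mle"
    and E: "ideal E type_ring" and stable: "\<And>\<sigma>. \<sigma> \<in> carrier G \<Longrightarrow> Poly_Mapping.map (act \<sigma>) ` E \<subseteq> E"
    and rgb: "reduced_groebner_basis mle E B"
  shows "coeffs_of B \<subseteq> fixed_field G act"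
proof -
  interpret monomial_order mle using mle by unfold_locales
  have gb: "groebner_basis mle E B" using rgb by (simp add: reduced_groebner_basis_def)
  have invariant: "Poly_Mapping.map (act \<sigma>) g = g" if \<sigma>: "\<sigma> \<in> carrier G" and g: "g \<in> B" for \<sigma> g
  proof (rule ccontr)
    define d where "d = Poly_Mapping.map (act \<sigma>) g - g"
    assume "Poly_Mapping.map (act \<sigma>) g \<noteq> g"
    then have "d \<noteq> 0" by (simp add: d_def)
    have monic: "g \<noteq> 0" "Poly_Mapping.lookup g (lead_monom mle g) = 1"
      using rgb g by (auto simp: reduced_groebner_basis_def)
    have "g \<in> E" using gb g by (auto simp: groebner_basis_def)
    then have "d \<in> E"
      unfolding d_def using stable[OF \<sigma>] by (intro type_ring_idealD(4)[OF E]) auto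
    then obtain h u where h: "h \<in> B" "h \<noteq> 0" "lead_monom mle d = lead_monom mle h + u"
      using groebner_basis_reducible[OF gb _ \<open>d \<noteq> 0\<close>] by (auto simp: monom_reducible_def)
    have lookup_d: "Poly_Mapping.lookup d t = act \<sigma> (Poly_Mapping.lookup g t) - Poly_Mapping.lookup g t" for t
      by (simp add: d_def lookup_minus lookup_map_act[OF \<sigma>])
    have d_key: "Poly_Mapping.lookup d (lead_monom mle d) \<noteq> 0"
      using lead_monom_in_keys[OF \<open>d \<noteq> 0\<close>] by (simp add: in_keys_iff)
    then have g_key: "lead_monom mle d \<in> Poly_Mapping.keys g"
      by (auto simp: lookup_d in_keys_iff act_0[OF \<sigma>])
    then have "h = g"
      using rgb g h(1,3) unfolding reduced_groebner_basis_def by (metis Diff_iff singletonD)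
    then have "mle (lead_monom mle g) (lead_monom mle d)"
      using h(3) mle_add_right by simp
    then have "lead_monom mle d = lead_monom mle g"
      using lead_monom_max[OF monic(1) g_key] mle_antisym by blast
    then show False using d_key monic(2) by (simp add: lookup_d act_1[OF \<sigma>])
  qed
  have "act \<sigma> (Poly_Mapping.lookup g t) = Poly_Mapping.lookup g t"
    if "\<sigma> \<in> carrier G" "g \<in> B" for \<sigma> g t
    using lookup_map_act[OF that(1), of g t] by (simp add: invariant[OF that])
  then show ?thesis by (auto simp: coeffs_of_def fixed_field_def)
qed

text \<open>
  All data in the relation \<open>f(a) = b * g(a)\<close> except \<open>a\<close> are invariant, so applying \<open>\<sigma>\<close> shows that
  \<open>f - b g\<close> vanishes at \<open>\<sigma> a\<close> as well.
\<close>

lemma invariant_relation_in_derksen_ideal: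
  assumes f: "f \<in> polys_over (fixed_field G act)" and g: "g \<in> polys_over (fixed_field G act)"
    and b: "b \<in> fixed_field G act" and "poly_eval a f = b * poly_eval a g"
  shows "f - Const b * g \<in> derksen_ideal G act a"
proof -
  have "f - Const b * g \<in> polys_over (fixed_field G act)"
    by (rule polys_over_diff[OF fixed_field_subring f
          polys_over_mult[OF fixed_field_subring polys_over_Const[OF fixed_field_subring b] g]])
  then have "poly_eval (\<lambda>i. act \<sigma> (a i)) (f - Const b * g) = 0" if "\<sigma> \<in> carrier G" for \<sigma>
    using that assms(4) poly_eval_act[of \<sigma> "f - Const b * g" a]
    by (simp add: poly_eval_diff[of a] poly_eval_mult[of a] act_0)
  then show ?thesis
    unfolding derksen_ideal_def by (intro INT_I vanishing_in_point_ideal)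
qed

text \<open>
  This is where tameness enters. The denominators of \<open>b\<close> form a nonzero subset \<open>J\<close> of \<open>R\<close> that is
  stable under \<open>G\<close> since \<open>b\<close> is invariant and \<open>R\<close> is stable. If \<open>J\<close> were contained in the ideal \<open>I\<close>
  of values at \<open>a\<close>, it would be contained in every conjugate of \<open>I\<close>, and so in \<open>0\<close>.
\<close>

lemma invariant_fraction_denominator:
  assumes K: "subring K type_ring" "K \<subseteq> fixed_field G act"
    and R: "R = subalgebra_gen K (range a)"
    and stable: "\<forall>\<sigma>\<in>carrier G. act \<sigma> ` R \<subseteq> R"
    and quot: "quot_field R = UNIV"
    and nilp: "nilpotent_ideal R (\<Inter>\<sigma>\<in>carrier G. act \<sigma> ` (poly_eval a ` (polys_over K \<inter> E)))"
    and b: "b \<in> fixed_field G act"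
  obtains f g where "f \<in> polys_over K" and "g \<in> polys_over K" and "g \<notin> E"
    and "poly_eval a f = b * poly_eval a g"
proof -
  define J where "J = {r \<in> R. r * b \<in> R}"
  define I where "I = poly_eval a ` (polys_over K \<inter> E)"
  have R_sub: "R \<subseteq> poly_eval a ` polys_over K"
    unfolding R by (rule subalgebra_gen_subset_poly_eval[OF K(1)])
  have "1 \<in> R"
    unfolding R by (rule subring_type_ringD(2)[OF subalgebra_gen_subring])
  then have I0: "(\<Inter>\<sigma>\<in>carrier G. act \<sigma> ` I) \<subseteq> {0}"
    using nilp unfolding I_def by (rule nilpotent_ideal_subset_0)
  have "b \<in> quot_field R" using quot by simp
  then obtain x y where "b = x / y" "x \<in> R" "y \<in> R" "y \<noteq> 0"
    unfolding quot_field_def by blast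
  then have y: "y \<in> J" "y \<noteq> 0" by (simp_all add: J_def)
  have "\<not> J \<subseteq> I"
  proof
    assume "J \<subseteq> I"
    have "y \<in> act \<sigma> ` I" if \<sigma>: "\<sigma> \<in> carrier G" for \<sigma>
    proof -
      have inv: "inv\<^bsub>G\<^esub> \<sigma> \<in> carrier G"
        using \<sigma> group.inv_closed[OF group_hom.axioms(1)[OF group_hom]] by blast
      have "act (inv\<^bsub>G\<^esub> \<sigma>) y * b = act (inv\<^bsub>G\<^esub> \<sigma>) (y * b)"
        using b inv by (simp add: act_mult fixed_field_def)
      then have "act (inv\<^bsub>G\<^esub> \<sigma>) y \<in> J"
        using y(1) stable inv by (auto simp: J_def)
      moreover have "y = act \<sigma> (act (inv\<^bsub>G\<^esub> \<sigma>) y)"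
        using composition_rule[of y \<sigma> "inv\<^bsub>G\<^esub> \<sigma>"] \<sigma> inv
          group.r_inv[OF group_hom.axioms(1)[OF group_hom] \<sigma>] by simp
      ultimately show ?thesis using \<open>J \<subseteq> I\<close> by blast
    qed
    then show False using I0 y(2) by blast
  qed
  then obtain r where r: "r \<in> R" "r * b \<in> R" "r \<notin> I" by (auto simp: J_def)
  obtain g where g: "g \<in> polys_over K" "r = poly_eval a g" using r(1) R_sub by blast
  obtain f where f: "f \<in> polys_over K" "r * b = poly_eval a f" using r(2) R_sub by blast
  have "g \<notin> E" using r(3) g by (auto simp: I_def)
  with f g show thesis using that[of f g] by (simp add: mult.commute)
qed

end

theorem theorem1p3:
  fixes G :: "('g, 'm) monoid_scheme"
    and act :: "'g \<Rightarrow> 'l::field \<Rightarrow> 'l"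
    and K R A :: "'l set"
    and a :: "'n::finite \<Rightarrow> 'l"
    and E \<G> :: "('n, 'l) mpoly set"
    and mle :: "('n \<Rightarrow>\<^sub>0 nat) \<Rightarrow> ('n \<Rightarrow>\<^sub>0 nat) \<Rightarrow> bool"
  assumes "acts_by_automorphisms G act"
    and "subring K type_ring" and "K \<subseteq> fixed_field G act"
    and "R = subalgebra_gen K (range a)"
    and "\<forall>\<sigma>\<in>carrier G. act \<sigma> ` R \<subseteq> R"
    and "quot_field R = UNIV"
    and "tamely_extended_derksen_ideal G act K a E"
    and "monomial_ordering mle"
    and "reduced_groebner_basis mle E \<G>"
    and "A = subalgebra_gen K (coeffs_of \<G>)"
  shows "fixed_field G act = quot_field A"
proof
  interpret field_action G act using assms(1) by unfold_locales
  interpret monomial_order mle using assms(8) by unfold_locales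
  have E: "ideal E type_ring" "\<And>\<sigma>. \<sigma> \<in> carrier G \<Longrightarrow> Poly_Mapping.map (act \<sigma>) ` E \<subseteq> E"
    "derksen_ideal G act a \<subseteq> E"
    and nilp: "nilpotent_ideal R (\<Inter>\<sigma>\<in>carrier G. act \<sigma> ` (poly_eval a ` (polys_over K \<inter> E)))"
    using assms(7) by (auto simp: tamely_extended_derksen_ideal_def extended_derksen_ideal_def assms(4))
  have A: "subring A type_ring" "K \<subseteq> A" "coeffs_of \<G> \<subseteq> A"
    unfolding assms(10) using subalgebra_gen_subring subalgebra_gen_superset by blast+
  show "quot_field A \<subseteq> fixed_field G act"
  proof (rule quot_field_fixed)
    have "coeffs_of \<G> \<subseteq> fixed_field G act"
      using assms(8) E(1,2) assms(9) by (rule reduced_groebner_basis_coeffs_fixed)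
    then show "A \<subseteq> fixed_field G act"
      unfolding assms(10) using assms(3) fixed_field_subring by (intro subalgebra_gen_minimal) auto
  qed
  show "fixed_field G act \<subseteq> quot_field A"
  proof
    fix b assume b: "b \<in> fixed_field G act"
    obtain f g where f: "f \<in> polys_over K" and g: "g \<in> polys_over K" "g \<notin> E"
      and fg: "poly_eval a f = b * poly_eval a g"
      using invariant_fraction_denominator[OF assms(2-6) nilp b] .
    have mono: "polys_over K \<subseteq> polys_over H" if "K \<subseteq> H" for H :: "'l set"
      using that by (auto simp: polys_over_def)
    have "f - Const b * g \<in> derksen_ideal G act a"
      by (rule invariant_relation_in_derksen_ideal[OF subsetD[OF mono[OF assms(3)] f]
            subsetD[OF mono[OF assms(3)] g(1)] b fg])
    then have rel: "f - Const b * g \<in> E" using E(3) by blast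
    have coeffs: "\<G> \<subseteq> polys_over A"
    proof
      fix p assume "p \<in> \<G>"
      then have "Poly_Mapping.lookup p m \<in> A" if "m \<in> Poly_Mapping.keys p" for m
        using that A(3) unfolding coeffs_of_def by blast
      then show "p \<in> polys_over A"
        using subring_type_ringD(1)[OF A(1)] unfolding polys_over_iff in_keys_iff by metis
    qed
    have gb: "groebner_basis mle E \<G>"
      using assms(9) by (simp add: reduced_groebner_basis_def)
    have monic: "Poly_Mapping.lookup p (lead_monom mle p) = 1" if "p \<in> \<G>" for p
      using assms(9) that by (auto simp: reduced_groebner_basis_def)
    show "b \<in> quot_field A"
      by (rule ratio_in_quot_field[OF A(1) E(1) gb coeffs monic
            subsetD[OF mono[OF A(2)] f] subsetD[OF mono[OF A(2)] g(1)] g(2) rel])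
  qed
qed

end
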